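(* Let $L$ be a positive integer. Let $k \geq 2$ and let $p_1, \ldots, p_k$ be distinct odd primes dividing the Fibonacci number $F_L$ such that for each $i$ we have $p_i \equiv 1 \pmod{L}$ or $p_i \equiv -1 \pmod{L}$ (assuming at least two such primes exist). Then $P := \prod_{i=1}^k p_i$ is a Fibonacci pseudoprime.
   Context: $F_n$ denotes the $n$-th Fibonacci number, with the standard indexing $F_0 = 0$, $F_1 = 1$, $F_{n+2} = F_{n+1} + F_n$. An odd composite positive integer $n$ is called a Fibonacci pseudoprime if $n \mid F_{n - (\frac{5}{n})}$, where $(\frac{5}{n})$ is the Jacobi symbol. *)

theory Defs
  imports "HOL-Number_Theory.Number_Theory"
begin

text \<open>
  The Jacobi symbol, as the product of Legendre symbols over the prime factors of \<open>n\<close>,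
  counted with multiplicity.  It is meaningful for odd positive \<open>n\<close> only.
\<close>

definition Jacobi :: "int \<Rightarrow> nat \<Rightarrow> int" where
  "Jacobi a n = (\<Prod>p\<in>#prime_factorization n. Legendre a (int p))"

text \<open>
  The index \<open>n - (5/n)\<close> is formed in the integers, where the symbol may be negative.
  It is nonnegative for \<open>n > 1\<close>, so \<open>nat\<close> does not truncate.
\<close>

definition Fibonacci_pseudoprime :: "nat \<Rightarrow> bool" where
  "Fibonacci_pseudoprime n \<longleftrightarrow>
     odd n \<and> n > 1 \<and> \<not> prime n \<and> n dvd fib (nat (int n - Jacobi 5 n))"

end

theory Submission
  imports Defs
begin

text \<open>
  Expanding Binet's formula by the binomial theorem gives \<open>F\<^sub>p \<equiv> (5/p)\<close> and
  \<open>2 F\<^bsub>p+1\<^esub> \<equiv> 1 + (5/p)\<close> modulo an odd prime \<open>p\<close>. Hence \<open>p dvd F\<^bsub>p-1\<^esub>\<close> forces \<open>(5/p) = 1\<close>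
  and \<open>p dvd F\<^bsub>p+1\<^esub>\<close> forces \<open>(5/p) = -1\<close>. If \<open>p dvd F\<^sub>L\<close> and \<open>p \<equiv> \<plusminus>1 (mod L)\<close>, then
  \<open>L dvd p \<mp> 1\<close>, so \<open>p\<close> divides the corresponding Fibonacci number and \<open>p \<equiv> (5/p) (mod L)\<close>.
  Multiplying these congruences, \<open>L\<close> divides \<open>P - (5/P)\<close>, so \<open>P dvd F\<^sub>L dvd F\<^bsub>P-(5/P)\<^esub>\<close>.
\<close>

text \<open>Follows from gcd(F_m, F_n) = F_gcd(m,n), where the gcd of the indices is
  \<open>m\<close>.\<close>

lemma fib_dvd_fib:
  assumes "m dvd n"
  shows "fib m dvd fib n"
  using assms by (metis fib_gcd gcd_nat.absorb_iff1)

text \<open>Binet's formula with denominators cleared: in (1 + sqrt 5)^n - (1 - sqrt 5)^n the even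
  powers of sqrt 5 cancel and the odd ones double.\<close>

lemma power_two_mult_fib:
  "2 ^ n * fib n = 2 * (\<Sum>j\<le>n. if odd j then (n choose j) * 5 ^ (j div 2) else 0)"
proof -
  have *: "(sqrt 5) ^ j - (- sqrt 5) ^ j = 2 * sqrt 5 * (if odd j then 5 ^ (j div 2) else 0)" for j
    by (auto elim!: oddE simp: power_mult)
  have "sqrt 5 * (2 ^ n * real (fib n)) = 2 ^ n * (((1 + sqrt 5) / 2) ^ n - ((1 - sqrt 5) / 2) ^ n)"
    by (simp add: fib_closed_form)
  also have "\<dots> = (sqrt 5 + 1) ^ n - (- sqrt 5 + 1) ^ n"
    by (simp add: power_divide field_simps)
  also have "\<dots> = (\<Sum>j\<le>n. real (n choose j) * ((sqrt 5) ^ j - (- sqrt 5) ^ j))"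
    by (simp only: binomial_ring power_one mult_1_right sum_subtractf right_diff_distrib)
  also have "\<dots> = sqrt 5 * (2 * (\<Sum>j\<le>n. if odd j then real (n choose j) * 5 ^ (j div 2) else 0))"
    unfolding * sum_distrib_left by (intro sum.cong) auto
  finally have "2 ^ n * real (fib n) =
      2 * (\<Sum>j\<le>n. if odd j then real (n choose j) * 5 ^ (j div 2) else 0)"
    by simp
  also have "\<dots> = real (2 * (\<Sum>j\<le>n. if odd j then (n choose j) * 5 ^ (j div 2) else 0))"
    by (simp add: if_distrib cong: if_cong)
  finally have "real (2 ^ n * fib n) = \<dots>" by simp
  then show ?thesis by (simp only: of_nat_eq_iff)
qed

context
  fixes p :: nat
  assumes p: "prime p" "odd p"
begin

lemma odd_prime_gt_2: "p > 2"
  using p prime_ge_2_nat[of p] by (cases "p = 2") auto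

lemma two_power_prime_cong: "[2 ^ p = (2::int)] (mod int p)"
proof -
  have "\<not> p dvd 2" using odd_prime_gt_2 by (auto dest: dvd_imp_le)
  then have "[2 ^ (p - 1) = (1::nat)] (mod p)"
    using fermat_theorem p by blast
  then have "[2 * 2 ^ (p - 1) = (2 * 1::nat)] (mod p)"
    by (rule cong_scalar_left)
  then have "[2 ^ p = (2::nat)] (mod p)"
    using odd_prime_gt_2 by (simp flip: power_Suc)
  then have "[int (2 ^ p) = int 2] (mod int p)"
    by (simp only: cong_int_iff)
  then show ?thesis by simp
qed

lemma cong_cancel_two:
  assumes "[2 * a = 2 * b] (mod int p)"
  shows "[a = b] (mod int p)"
  using assms p by (subst (asm) cong_mult_lcancel) auto

text \<open>Euler's criterion, with the exponent written as in the term \<open>j = p\<close> of the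
  binomial sum.\<close>

lemma Legendre_5_cong: "[Legendre 5 (int p) = 5 ^ (p div 2)] (mod int p)"
proof -
  have "(p - 1) div 2 = p div 2" using p by (auto elim!: oddE)
  then show ?thesis
    using euler_criterion[of p 5] p odd_prime_gt_2 by simp
qed

text \<open>For odd \<open>j < p\<close> the binomial coefficient is divisible by \<open>p\<close>,
  so only the term \<open>j = p\<close> survives. By Fermat the factor \<open>2 ^ p\<close> is 2
  modulo \<open>p\<close> and cancels against the 2 before the sum.\<close>

lemma fib_prime_cong: "[int (fib p) = Legendre 5 (int p)] (mod int p)"
proof -
  let ?t = "\<lambda>j. if odd j then (p choose j) * 5 ^ (j div 2) else 0"
  have "[(\<Sum>j\<le>p. ?t j) = (\<Sum>j\<le>p. if j = p then 5 ^ (p div 2) else 0)] (mod p)"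
  proof (rule cong_sum)
    fix j assume "j \<in> {..p}"
    moreover have "p dvd (p choose j)" if "j < p" "odd j"
      using that p by (intro dvd_choose_prime) (auto elim: oddE)
    ultimately show "[?t j = (if j = p then 5 ^ (p div 2) else 0)] (mod p)"
      using p by (auto simp: cong_0_iff)
  qed
  then have S: "[(\<Sum>j\<le>p. ?t j) = 5 ^ (p div 2)] (mod p)" by simp
  have "[int (\<Sum>j\<le>p. ?t j) = int (5 ^ (p div 2))] (mod int p)"
    using S by (simp only: cong_int_iff)
  then have S': "[2 * int (\<Sum>j\<le>p. ?t j) = 2 * Legendre 5 (int p)] (mod int p)"
    using Legendre_5_cong by (intro cong_scalar_left) (auto intro: cong_trans cong_sym)
  have "[2 * int (fib p) = 2 ^ p * int (fib p)] (mod int p)"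
    by (intro cong_scalar_right cong_sym[OF two_power_prime_cong])
  also have "2 ^ p * int (fib p) = int (2 ^ p * fib p)" by simp
  also have "\<dots> = 2 * int (\<Sum>j\<le>p. ?t j)" by (subst power_two_mult_fib) simp
  also note S'
  finally show ?thesis by (rule cong_cancel_two)
qed

text \<open>By Pascal's rule \<open>p\<close> divides \<open>Suc p choose j\<close> for
  \<open>1 < j < p\<close>. The surviving terms \<open>j = 1\<close> and \<open>j = p\<close> both
  have coefficient p + 1, which is 1 modulo \<open>p\<close>. Since \<open>2 ^ Suc p\<close> is 4
  modulo \<open>p\<close>, one factor 2 remains.\<close>

lemma fib_Suc_prime_cong: "[2 * int (fib (Suc p)) = 1 + Legendre 5 (int p)] (mod int p)"
proof -
  let ?t = "\<lambda>j. if odd j then (Suc p choose j) * 5 ^ (j div 2) else 0"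
  let ?u = "\<lambda>j. (if j = 1 then 1 else 0 :: nat) + (if j = p then 5 ^ (p div 2) else 0)"
  have "[(\<Sum>j\<le>Suc p. ?t j) = (\<Sum>j\<le>Suc p. ?u j)] (mod p)"
  proof (rule cong_sum)
    fix j assume j: "j \<in> {..Suc p}"
    show "[?t j = ?u j] (mod p)"
    proof (cases "odd j \<and> j \<noteq> 1 \<and> j \<noteq> p")
      case True
      \<comment> \<open>The value \<open>j = Suc p\<close> is excluded by parity.\<close>
      with j p have "1 < j" "j < p" by (auto elim!: oddE)
      then obtain i where i: "j = Suc i" "0 < i" "i < p" by (cases j) auto
      have "p dvd (p choose i)" "p dvd (p choose Suc i)"
        using i \<open>j < p\<close> p by (auto intro!: dvd_choose_prime)
      then have "p dvd (Suc p choose j)" using i by simp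
      then show ?thesis using True by (auto simp: cong_0_iff)
    next
      case False
      have "[1 + p = 1] (mod p)" by (simp only: cong_def mod_add_self2)
      then have "[(1 + p) * 5 ^ (p div 2) = 1 * 5 ^ (p div 2)] (mod p)"
        by (rule cong_scalar_right)
      moreover have "Suc p mod p = Suc 0" using odd_prime_gt_2 by (simp add: mod_Suc)
      moreover have "p \<noteq> Suc 0" "even j \<Longrightarrow> j \<noteq> p" using p by auto
      ultimately show ?thesis using False p by (auto simp: cong_def)
    qed
  qed
  also have "(\<Sum>j\<le>Suc p. ?u j) = 1 + 5 ^ (p div 2)"
    by (simp only: sum.distrib sum.delta finite_atMost) simp
  finally have S: "[(\<Sum>j\<le>Suc p. ?t j) = 1 + 5 ^ (p div 2)] (mod p)" .
  have "[int (\<Sum>j\<le>Suc p. ?t j) = int (1 + 5 ^ (p div 2))] (mod int p)"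
    using S by (simp only: cong_int_iff)
  also have "[int (1 + 5 ^ (p div 2)) = 1 + Legendre 5 (int p)] (mod int p)"
    using cong_add[OF cong_refl[of 1] cong_sym[OF Legendre_5_cong]] by simp
  finally have S': "[2 * int (\<Sum>j\<le>Suc p. ?t j) = 2 * (1 + Legendre 5 (int p))] (mod int p)"
    by (rule cong_scalar_left)
  have "[2 * (2 * int (fib (Suc p))) = 2 ^ p * (2 * int (fib (Suc p)))] (mod int p)"
    by (intro cong_scalar_right cong_sym[OF two_power_prime_cong])
  also have "2 ^ p * (2 * int (fib (Suc p))) = int (2 ^ Suc p * fib (Suc p))" by simp
  also have "\<dots> = 2 * int (\<Sum>j\<le>Suc p. ?t j)"
    by (subst power_two_mult_fib) simp
  also note S'
  finally show ?thesis by (rule cong_cancel_two)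
qed

text \<open>Both values lie in {-1, 0, 1}, so they differ by at most 2, which is less than
  \<open>p\<close>.\<close>

lemma Legendre_eqI:
  assumes "[Legendre 5 (int p) = e] (mod int p)" "e = 1 \<or> e = -1"
  shows "Legendre 5 (int p) = e"
proof -
  have "int p dvd Legendre 5 (int p) - e" using assms(1) by (simp add: cong_iff_dvd_diff)
  moreover have "\<bar>Legendre 5 (int p) - e\<bar> < int p"
    using assms(2) odd_prime_gt_2 by (auto simp: Legendre_def)
  ultimately show ?thesis by (metis dvd_imp_le_int eq_iff_diff_eq_0 not_less abs_of_nat)
qed

text \<open>With e the symbol, F_(p+1) = F_p + F_(p-1) is congruent to e, so 2e is congruent to 1 +
  e.\<close>

lemma Legendre_5_eq_1:
  assumes "p dvd fib (p - 1)"
  shows "Legendre 5 (int p) = 1"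
proof (rule Legendre_eqI)
  let ?e = "Legendre 5 (int p)"
  obtain q where q: "p = Suc q" using odd_prime_gt_2 by (cases p) auto
  have "int p dvd int (fib (p - 1))" using assms by simp
  then have 1: "[int (fib p) + int (fib (p - 1)) = int (fib p)] (mod int p)"
    by (simp add: cong_iff_dvd_diff)
  have "int (fib (Suc p)) = int (fib p) + int (fib (p - 1))" by (simp add: q)
  then have "[int (fib (Suc p)) = ?e] (mod int p)"
    using 1 fib_prime_cong by (metis cong_trans)
  then have "[2 * int (fib (Suc p)) = 2 * ?e] (mod int p)" by (rule cong_scalar_left)
  then have "[2 * ?e = 1 + ?e] (mod int p)"
    using fib_Suc_prime_cong by (metis cong_trans cong_sym)
  then show "[?e = 1] (mod int p)" by (simp add: cong_iff_dvd_diff)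
qed simp

text \<open>Here 2 F_(p+1) vanishes modulo \<open>p\<close>, hence so does 1 + e, where e is the
  symbol.\<close>

lemma Legendre_5_eq_minus_1:
  assumes "p dvd fib (p + 1)"
  shows "Legendre 5 (int p) = -1"
proof (rule Legendre_eqI)
  let ?e = "Legendre 5 (int p)"
  have "int p dvd int (fib (Suc p))" using assms by simp
  then have "[2 * int (fib (Suc p)) = 0] (mod int p)"
    unfolding cong_0_iff by (rule dvd_mult)
  then have "[1 + ?e = 0] (mod int p)"
    using fib_Suc_prime_cong by (metis cong_trans cong_sym)
  then show "[?e = -1] (mod int p)"
    by (simp add: cong_iff_dvd_diff add.commute)
qed simp

text \<open>Replaces the sign, which may vary with the prime, by the symbol, so that the congruences
  can be multiplied.\<close>

lemma prime_cong_Legendre_5: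
  assumes "p dvd fib L" and "[int p = 1] (mod int L) \<or> [int p = -1] (mod int L)"
  shows "[int p = Legendre 5 (int p)] (mod int L)"
  using assms(2)
proof
  assume c: "[int p = 1] (mod int L)"
  then have "int L dvd int (p - 1)"
    using odd_prime_gt_2 by (simp add: cong_iff_dvd_diff of_nat_diff)
  then have "p dvd fib (p - 1)"
    using assms(1) fib_dvd_fib dvd_trans by (metis of_nat_dvd_iff)
  then show ?thesis using c Legendre_5_eq_1 by simp
next
  assume c: "[int p = -1] (mod int L)"
  then have "int L dvd int (p + 1)"
    by (simp add: cong_iff_dvd_diff add.commute)
  then have "p dvd fib (p + 1)"
    using assms(1) fib_dvd_fib dvd_trans by (metis of_nat_dvd_iff)
  then show ?thesis using c Legendre_5_eq_minus_1 by simp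
qed

end

lemma Jacobi_prod_primes:
  assumes "\<And>i. i \<in> A \<Longrightarrow> prime (p i)"
  shows "Jacobi a (\<Prod>i\<in>A. p i) = (\<Prod>i\<in>A. Legendre a (int (p i)))"
\<comment> \<open>For infinite \<open>A\<close> both products are 1 by convention, and the symbol
  over 1 is the empty product.\<close>
proof (cases "finite A")
  case True
  then show ?thesis
    using assms
  proof (induction A rule: finite_induct)
    case (insert x A)
    have "(\<Prod>i\<in>A. p i) \<noteq> 0"
      using insert.hyps insert.prems by (auto intro!: prime_gt_0_nat)
    moreover have "p x \<noteq> 0" using insert.prems[of x] by (auto intro!: gr0I)
    ultimately show ?case
      using insert by (simp add: Jacobi_def prime_factorization_mult prime_factorization_prime)
  qed (simp add: Jacobi_def)
qed (simp add: Jacobi_def)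

text \<open>Every Legendre factor has absolute value at most 1. The bound keeps the index P - (5/P)
  from being negative.\<close>

lemma Jacobi_le_1: "Jacobi a n \<le> 1"
proof -
  have "\<bar>\<Prod>p\<in>#M. Legendre a (int p)\<bar> \<le> 1" for M
    by (induction M) (auto simp: abs_mult Legendre_def)
  from this[of "prime_factorization n"] show ?thesis
    unfolding Jacobi_def by linarith
qed

theorem theorem1p1:
  fixes L k :: nat and p :: "nat \<Rightarrow> nat"
  assumes "L > 0"
    and "k \<ge> 2"
    and "inj_on p {1..k}"
    and "\<And>i. i \<in> {1..k} \<Longrightarrow> prime (p i) \<and> odd (p i) \<and> p i dvd fib L"
    and "\<And>i. i \<in> {1..k} \<Longrightarrow>
           [int (p i) = 1] (mod int L) \<or> [int (p i) = -1] (mod int L)"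
  shows "Fibonacci_pseudoprime (\<Prod>i=1..k. p i)"
proof -
  let ?P = "\<Prod>i=1..k. p i"
  have split: "?P = p 1 * (\<Prod>i=2..k. p i)"
    using assms(2) by (simp add: prod.atLeast_Suc_atMost numeral_2_eq_2)
  have p1: "p 1 > 1" using assms(2) assms(4)[of 1] prime_gt_1_nat by auto
  have p2: "p 2 > 1" using assms(2) assms(4)[of 2] prime_gt_1_nat by auto
  \<comment> \<open>Here \<open>k \<ge> 2\<close> enters: the cofactor of \<open>p 1\<close> is a
    multiple of \<open>p 2\<close>, so the factorization is proper.\<close>
  have "p 2 dvd (\<Prod>i=2..k. p i)" using assms(2) by (intro dvd_prodI) auto
  then have tail: "(\<Prod>i=2..k. p i) \<noteq> 1" using p2 by auto
  have pos: "?P > 0" using assms(4) by (intro prod_pos) (auto simp: prime_gt_0_nat)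
  have not_prime: "\<not> prime ?P"
    using split p1 tail by (metis prime_product nat_neq_iff)
  have "?P \<noteq> 1" using split p1 by auto
  with pos have gt1: "?P > 1" by linarith
  have odd: "odd ?P" using assms(4) by (auto simp: even_prod_iff)
  \<comment> \<open>Distinct primes are pairwise coprime, so their separate divisibilities
    combine.\<close>
  have P_dvd: "?P dvd fib L"
    unfolding cong_0_iff[symmetric] using assms(3,4)
    by (intro cong_cong_prod_coprime_nat) (auto simp: cong_0_iff intro!: primes_coprime dest: inj_onD)
  have "[(\<Prod>i=1..k. int (p i)) = (\<Prod>i=1..k. Legendre 5 (int (p i)))] (mod int L)"
    using assms(4,5) by (intro cong_prod prime_cong_Legendre_5) auto
  then have "[int ?P = Jacobi 5 ?P] (mod int L)"
    using assms(4) by (subst Jacobi_prod_primes) auto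
  then have "int L dvd int (nat (int ?P - Jacobi 5 ?P))"
    using Jacobi_le_1[of 5 ?P] gt1 by (simp add: cong_iff_dvd_diff)
  then have "fib L dvd fib (nat (int ?P - Jacobi 5 ?P))"
    by (intro fib_dvd_fib) (simp only: of_nat_dvd_iff)
  with P_dvd odd gt1 not_prime show ?thesis
    unfolding Fibonacci_pseudoprime_def by (auto intro: dvd_trans)
qed

end
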